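(* Let $\mathbf{s}$ be a Sturmian word of slope $\alpha=[0;a_1+1,a_2,a_3,\ldots]$. For each $\ell\ge 2$ there exists $k_\ell\in\mathbb{N}$ such that for every $k\ge k_\ell$ there is a morphism $h_{k,\ell}$ (from $\{0,1\}^*$ to the free monoid over $2^{\{0,1\}^\ell\times\{0,1\}^\ell}$) such that $T\partial_{\mathbf{s},\ell}=h_{k,\ell}(\mathbf{s}_{\beta_k,\beta_k})$, where $\beta_k=[0;a_{k+1}+1,a_{k+2},a_{k+3},\ldots]$.
   Context: $[0;b_1,b_2,b_3,\ldots]$ denotes the infinite simple continued fraction $1/(b_1+1/(b_2+1/(b_3+\cdots)))$ with integers $b_i\ge 1$ (so here $a_1\ge 0$ and $a_i\ge 1$ for $i\ge 2$). Let $\mathbb{T}=[0,1)$ and $\alpha,\rho\in\mathbb{T}$ with $\alpha$ irrational. Let $R_\alpha(x)=\{x+\alpha\}$ (fractional part). Let $I_0=[0,1-\alpha)$ (or, in the other convention, $I_0=(0,1-\alpha]$) and $I_1=\mathbb{T}\setminus I_0$. Put $\nu(x)=0$ if $x\in I_0$ and $\nu(x)=1$ otherwise. The Sturmian word $\mathbf{s}_{\alpha,\rho}$ of slope $\alpha$ and intercept $\rho$ is defined by $\mathbf{s}_{\alpha,\rho}[n]=\nu(R_\alpha^n(\rho))$, $n\ge 0$. The characteristic Sturmian word of slope $\alpha$ is $\mathbf{s}_{\alpha,\alpha}$. For an infinite word $\mathbf{x}$ over a finite alphabet $A$ and $\ell\ge 1$, the $\ell$-boundary sequence is $\partial_{\mathbf{x},\ell}=(\partial_{\mathbf{x},\ell}[n])_{n\ge\ell}$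 where $\partial_{\mathbf{x},\ell}[n]=\{(u,v)\in A^\ell\times A^\ell\mid uyv\text{ is a factor of }\mathbf{x}\text{ for some }y\in A^{n-\ell}\}$. The shift $T$ removes the first term of a sequence, so $T\partial_{\mathbf{x},\ell}=\partial_{\mathbf{x},\ell}[\ell+1]\,\partial_{\mathbf{x},\ell}[\ell+2]\cdots$. *)

theory Defs
  imports Complex_Main "HOL-Library.Z2" "HOL-Library.Omega_Words_Fun"
begin

text \<open>
  Infinite words are those of \<^theory>\<open>HOL-Library.Omega_Words_Fun\<close>, finite words are lists.
  The alphabet \<open>{0, 1}\<close> is the two-element type \<^typ>\<open>bit\<close>; its field structure plays no role.
\<close>

fun finite_cf :: "nat list \<Rightarrow> real" where
  "finite_cf [] = 0"
| "finite_cf (b # bs) = 1 / (real b + finite_cf bs)"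

text \<open>
  The value of \<open>[0; b 1, b 2, b 3, \<dots>]\<close>. The entry \<open>b 0\<close> is ignored. The limit exists
  whenever \<open>b i \<ge> 1\<close> for all \<open>i \<ge> 1\<close>.
\<close>

definition cf :: "(nat \<Rightarrow> nat) \<Rightarrow> real" where
  "cf b = lim (\<lambda>n. finite_cf (map b [1..<Suc n]))"

definition slope_cf :: "(nat \<Rightarrow> nat) \<Rightarrow> real" where
  "slope_cf a = cf (\<lambda>i. if i = 1 then a 1 + 1 else a i)"

text \<open>The two conventions for the interval \<open>I\<^sub>0\<close>: \<open>[0, 1 - \<alpha>)\<close> and \<open>(0, 1 - \<alpha>]\<close>.\<close>

datatype convention = Left_Closed | Right_Closed

fun I0 :: "convention \<Rightarrow> real \<Rightarrow> real set" where
  "I0 Left_Closed \<alpha> = {0..<1 - \<alpha>}"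
| "I0 Right_Closed \<alpha> = {0<..1 - \<alpha>}"

definition rotation :: "real \<Rightarrow> real \<Rightarrow> real" where
  "rotation \<alpha> x = frac (x + \<alpha>)"

definition sturmian :: "convention \<Rightarrow> real \<Rightarrow> real \<Rightarrow> bit word" where
  "sturmian c \<alpha> \<rho> = (\<lambda>n. if (rotation \<alpha> ^^ n) \<rho> \<in> I0 c \<alpha> then 0 else 1)"

definition is_sturmian_of_slope :: "convention \<Rightarrow> real \<Rightarrow> bit word \<Rightarrow> bool" where
  "is_sturmian_of_slope c \<alpha> s \<longleftrightarrow>
     \<alpha> \<in> {0..<1} \<and> \<alpha> \<notin> \<rat> \<and> (\<exists>\<rho>\<in>{0..<1}. s = sturmian c \<alpha> \<rho>)"

definition characteristic_word :: "convention \<Rightarrow> real \<Rightarrow> bit word" where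
  "characteristic_word c \<alpha> = sturmian c \<alpha> \<alpha>"

definition is_factor :: "'a list \<Rightarrow> 'a word \<Rightarrow> bool" where
  "is_factor w x \<longleftrightarrow> (\<exists>i. w = x [i \<rightarrow> i + length w])"

definition words_of_length :: "nat \<Rightarrow> 'a list set" where
  "words_of_length n = {w. length w = n}"

text \<open>The \<open>n\<close>-th term of the \<open>l\<close>-boundary sequence; meaningful only for \<open>n \<ge> l\<close>.\<close>

definition boundary :: "'a word \<Rightarrow> nat \<Rightarrow> nat \<Rightarrow> ('a list \<times> 'a list) set" where
  "boundary x l n =
     {(u, v) \<in> words_of_length l \<times> words_of_length l.
        \<exists>y \<in> words_of_length (n - l). is_factor (u @ y @ v) x}"

text \<open>
  The sequence \<open>(boundary x l n)\<close> for \<open>n \<ge> l\<close>, reindexed so that position \<open>0\<close> holds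
  the term for \<open>n = l\<close>.
\<close>

definition boundary_seq :: "'a word \<Rightarrow> nat \<Rightarrow> ('a list \<times> 'a list) set word" where
  "boundary_seq x l = (\<lambda>i. boundary x l (l + i))"

definition shift_word :: "'a word \<Rightarrow> 'a word" where
  "shift_word x = suffix 1 x"

definition is_morphism :: "('a list \<Rightarrow> 'b list) \<Rightarrow> 'b set \<Rightarrow> bool" where
  "is_morphism h B \<longleftrightarrow>
     (\<forall>w. h w \<in> lists B) \<and> h [] = [] \<and> (\<forall>u v. h (u @ v) = h u @ h v)"

text \<open>
  \<open>y = h(x)\<close> for infinite words \<open>x\<close>, \<open>y\<close>: the images of the prefixes of \<open>x\<close> are prefixes
  of \<open>y\<close> of unbounded length. This is a relation because \<open>h(x)\<close> is a finite word
  if \<open>h\<close> erases almost all letters of \<open>x\<close>.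
\<close>

definition is_image :: "('a list \<Rightarrow> 'b list) \<Rightarrow> 'a word \<Rightarrow> 'b word \<Rightarrow> bool" where
  "is_image h x y \<longleftrightarrow>
     (\<forall>n. h (prefix n x) = prefix (length (h (prefix n x))) y) \<and>
     (\<forall>m. \<exists>n. m \<le> length (h (prefix n x)))"

end

theory Submission
  imports Defs "HOL-Analysis.Kronecker_Approximation_Theorem"
begin

text \<open>
  By density of the orbit, \<open>(u, v)\<close> lies in the \<open>n\<close>-th boundary set iff the half-open arc coded by \<open>u\<close>
  meets the arc coded by \<open>v\<close> translated by \<open>-n\<alpha>\<close>. This is decided by comparing endpoints, hence depends
  only on the numbers \<open>\<lfloor>n\<alpha> + j\<alpha>\<rfloor> - \<lfloor>n\<alpha>\<rfloor>\<close> with \<open>\<bar>j\<bar> \<le> l\<close>, provided \<open>n > l\<close>, so that no \<open>n\<alpha> + j\<alpha>\<close>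
  is an integer. These numbers can be read off the factor of length \<open>2l\<close> of the characteristic word
  at position \<open>n - l - 1\<close>: the shifted boundary sequence is a \<open>2l\<close>-block coding of that word.

  The characteristic word of slope \<open>\<alpha>\<close> is the image of that of slope \<open>\<beta>\<^sub>k\<close> under the composition of the
  morphisms \<open>0 \<mapsto> 0\<^bsup>a\<^esup>1\<close>, \<open>1 \<mapsto> 0\<close> for \<open>a = a\<^sub>1, \<dots>, a\<^sub>k\<close>. For large \<open>k\<close> the images of both letters have a
  long common prefix, so the \<open>2l\<close>-blocks that start in the image of a letter do not depend on the
  letters that follow, and the block coding becomes a morphism.
\<close>

section \<open>Images of infinite words under morphisms\<close>

definition morph :: "('a \<Rightarrow> 'b list) \<Rightarrow> 'a list \<Rightarrow> 'b list" where
  "morph f w = concat (map f w)"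

lemma morph_simps [simp]:
  "morph f [] = []" "morph f (b # w) = f b @ morph f w" "morph f (u @ v) = morph f u @ morph f v"
  by (simp_all add: morph_def)

lemma is_morphism_morph: "(\<And>b. f b \<in> lists B) \<Longrightarrow> is_morphism (morph f) B"
  by (fastforce simp: is_morphism_def morph_def)

lemma morph_morph: "morph g (morph f w) = morph (\<lambda>b. morph g (f b)) w"
  by (induction w) auto

lemma length_le_length_morph:
  assumes "\<And>b. f b \<noteq> []"
  shows "length w \<le> length (morph f w)"
proof (induction w)
  case (Cons b w)
  then show ?case using assms[of b] by (cases "f b") auto
qed simp

lemma prefix_Suc: "prefix (Suc n) x = prefix n x @ [x n]"
  by (simp add: subsequence_def)

lemma is_imageI:
  assumes "\<And>b. f b \<noteq> []"
    and step: "\<And>n i. i < length (f (x n)) \<Longrightarrow>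
      y (length (morph f (prefix n x)) + i) = f (x n) ! i"
  shows "is_image (morph f) x y"
  unfolding is_image_def
proof (intro conjI allI)
  show "morph f (prefix n x) = prefix (length (morph f (prefix n x))) y" for n
  proof (induction n)
    case (Suc n)
    let ?N = "length (morph f (prefix n x))"
    have "f (x n) = subsequence y ?N (?N + length (f (x n)))"
      by (rule nth_equalityI) (simp_all add: step)
    then show ?case using Suc by (simp add: prefix_Suc subsequence_append)
  qed (simp add: subsequence_def)
  show "\<exists>n. m \<le> length (morph f (prefix n x))" for m
    using length_le_length_morph[of f "prefix m x"] assms(1) by (auto simp: subsequence_def)
qed

text \<open>As \<open>g\<close> may erase letters, long \<open>f\<close>-images alone do not give
  long images: first a prefix of \<open>y\<close> with a long \<open>g\<close>-image is fixed, then
  a prefix of \<open>x\<close> whose \<open>f\<close>-image covers it.\<close>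

lemma is_image_comp:
  assumes f: "is_image (morph f) x y" and g: "is_image (morph g) y z"
  shows "is_image (morph (\<lambda>b. morph g (f b))) x z"
  unfolding is_image_def morph_morph[symmetric]
proof (intro conjI allI)
  show "morph g (morph f (prefix n x)) = prefix (length (morph g (morph f (prefix n x)))) z" for n
    using f g unfolding is_image_def by metis
  fix m
  obtain N where N: "m \<le> length (morph g (prefix N y))" using g unfolding is_image_def by blast
  obtain n where n: "N \<le> length (morph f (prefix n x))" using f unfolding is_image_def by blast
  define N' where "N' = length (morph f (prefix n x))"
  have "prefix N' y = prefix N y @ subsequence y N (N + (N' - N))"
    using n subsequence_append[of y N "N' - N"] by (simp add: N'_def)
  moreover have "morph f (prefix n x) = prefix N' y"
    using f unfolding is_image_def N'_def by blast
  ultimately show "\<exists>n. m \<le> length (morph g (morph f (prefix n x)))"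
    using N by (intro exI[of _ n]) simp
qed

text \<open>An \<open>L\<close>-block of \<open>x\<close> that starts inside the image of
  \<open>z n\<close> ends inside \<open>f (z n) @ p\<close>, because the image of the next letter
  begins with \<open>p\<close>. So \<open>z n\<close> alone determines all letters of
  \<open>y\<close> at these positions.\<close>

lemma is_image_block_coding:
  assumes img: "is_image (morph f) z x"
    and ne: "\<And>b. f b \<noteq> []"
    and pre: "\<And>b. take (length p) (f b) = p" and "L \<le> length p"
    and y: "\<And>m. y m = g (subsequence x m (m + L))"
  shows "is_image (morph (\<lambda>b. map (\<lambda>i. g (take L (drop i (f b @ p)))) [0..<length (f b)])) z y"
    (is "is_image (morph ?H) _ _")
proof (rule is_imageI)
  show "?H b \<noteq> []" for b using ne by simp
  fix n i assume i: "i < length (?H (z n))"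
  have len: "length (morph ?H w) = length (morph f w)" for w
    by (induction w) auto
  define N where "N = length (morph f (prefix n z))"
  define M where "M = length (morph f (prefix (Suc (Suc n)) z))"
  obtain r where r: "f (z (Suc n)) = p @ r"
    using pre[of "z (Suc n)"] by (metis append_take_drop_id)
  have "prefix M x = morph f (prefix (Suc (Suc n)) z)"
    using img unfolding is_image_def M_def by metis
  also have "\<dots> = morph f (prefix n z) @ f (z n) @ p @ r"
    by (simp add: prefix_Suc r)
  finally have M: "map x [0..<M] = (morph f (prefix n z) @ f (z n) @ p) @ r"
    by (simp add: subsequence_def)
  have M_len: "M = N + length (f (z n)) + length p + length r"
    using arg_cong[OF M, of length] by (simp add: N_def)
  have "(f (z n) @ p) ! j = x (N + j)" if "j < length (f (z n) @ p)" for j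
  proof -
    have "x (N + j) = map x [0..<M] ! (N + j)" using that M_len by simp
    also have "\<dots> = (f (z n) @ p) ! j" unfolding M using that by (auto simp: N_def nth_append)
    finally show ?thesis by simp
  qed
  then have "take L (drop i (f (z n) @ p)) = subsequence x (N + i) (N + i + L)"
    using i \<open>L \<le> length p\<close> by (intro nth_equalityI) (auto simp: add.assoc simp del: take_append drop_append)
  then show "y (length (morph ?H (prefix n z)) + i) = ?H (z n) ! i"
    using i by (simp add: len y N_def del: take_append drop_append)
qed

section \<open>Rotation coding by floors\<close>

text \<open>The orbit runs on the real line instead of the circle: a letter \<open>1\<close> marks
  the crossing of an integer, and \<open>x\<close> may be any real.\<close>

definition coding :: "real \<Rightarrow> real \<Rightarrow> bit word" where
  "coding \<alpha> x = (\<lambda>j. if \<lfloor>x + real (Suc j) * \<alpha>\<rfloor> = \<lfloor>x + real j * \<alpha>\<rfloor> then 0 else 1)"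

lemma coding_add: "coding \<alpha> x (i + j) = coding \<alpha> (x + real i * \<alpha>) j"
  by (simp add: coding_def algebra_simps)

text \<open>Since \<open>0 < \<alpha> < 1\<close>, each letter is the increment of the floor, so
  letters and floors relative to the start determine each other.\<close>

lemma prefix_coding_eq_iff:
  assumes "0 < \<alpha>" "\<alpha> < 1"
  shows "prefix l (coding \<alpha> x) = prefix l (coding \<alpha> y) \<longleftrightarrow>
    (\<forall>j\<le>l. \<lfloor>x + real j * \<alpha>\<rfloor> - \<lfloor>x\<rfloor> = \<lfloor>y + real j * \<alpha>\<rfloor> - \<lfloor>y\<rfloor>)"
proof (induction l)
  case (Suc l)
  have inc: "\<lfloor>z + real (Suc l) * \<alpha>\<rfloor> = \<lfloor>z + real l * \<alpha>\<rfloor> \<or>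
      \<lfloor>z + real (Suc l) * \<alpha>\<rfloor> = \<lfloor>z + real l * \<alpha>\<rfloor> + 1" for z
  proof -
    have "\<lfloor>w + \<alpha>\<rfloor> = \<lfloor>w\<rfloor> \<or> \<lfloor>w + \<alpha>\<rfloor> = \<lfloor>w\<rfloor> + 1" for w using assms by linarith
    from this[of "z + real l * \<alpha>"] show ?thesis by (simp add: algebra_simps)
  qed
  define A where "A = (\<forall>j\<le>l. \<lfloor>x + real j * \<alpha>\<rfloor> - \<lfloor>x\<rfloor> = \<lfloor>y + real j * \<alpha>\<rfloor> - \<lfloor>y\<rfloor>)"
  have "A \<Longrightarrow> \<lfloor>x + real l * \<alpha>\<rfloor> - \<lfloor>x\<rfloor> = \<lfloor>y + real l * \<alpha>\<rfloor> - \<lfloor>y\<rfloor>"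
    by (simp add: A_def)
  then have "A \<Longrightarrow> coding \<alpha> x l = coding \<alpha> y l \<longleftrightarrow>
      \<lfloor>x + real (Suc l) * \<alpha>\<rfloor> - \<lfloor>x\<rfloor> = \<lfloor>y + real (Suc l) * \<alpha>\<rfloor> - \<lfloor>y\<rfloor>"
    using inc[of x] inc[of y] unfolding coding_def by auto
  then show ?case using Suc.IH unfolding le_Suc_eq prefix_Suc A_def by auto
qed (simp add: subsequence_def)

lemma rotation_funpow:
  assumes "\<rho> \<in> {0..<1}"
  shows "(rotation \<alpha> ^^ n) \<rho> = frac (\<rho> + real n * \<alpha>)"
proof (induction n)
  case 0
  then show ?case using assms by (simp add: frac_eq)
next
  case (Suc n)
  have "frac (frac y + \<alpha>) = frac (y + \<alpha>)" for y
  proof -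
    have "frac y + \<alpha> = y + \<alpha> - of_int \<lfloor>y\<rfloor>" by (simp add: frac_def)
    then show ?thesis by (simp only: frac_def floor_diff_of_int)
  qed
  then show ?case using Suc by (simp add: rotation_def algebra_simps)
qed

lemma sturmian_Left_Closed:
  assumes "\<rho> \<in> {0..<1}" "0 < \<alpha>" "\<alpha> < 1"
  shows "sturmian Left_Closed \<alpha> \<rho> = coding \<alpha> \<rho>"
proof
  fix n
  have "frac y \<in> {0..<1 - \<alpha>} \<longleftrightarrow> \<lfloor>y + \<alpha>\<rfloor> = \<lfloor>y\<rfloor>" for y
    using assms unfolding frac_def by (simp; linarith)
  from this[of "\<rho> + real n * \<alpha>"] show "sturmian Left_Closed \<alpha> \<rho> n = coding \<alpha> \<rho> n"
    using assms by (simp add: sturmian_def coding_def rotation_funpow algebra_simps)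
qed

text \<open>Closing the interval on the right turns floors into ceilings; an orbit point at an
  integer lies outside \<open>I0\<close>, and there the ceiling does increase.\<close>

lemma sturmian_Right_Closed:
  assumes "\<rho> \<in> {0..<1}" "0 < \<alpha>" "\<alpha> < 1"
  shows "sturmian Right_Closed \<alpha> \<rho> n =
    (if \<lceil>\<rho> + real (Suc n) * \<alpha>\<rceil> = \<lceil>\<rho> + real n * \<alpha>\<rceil> then 0 else 1)"
proof -
  have "frac y \<in> {0<..1 - \<alpha>} \<longleftrightarrow> \<lceil>y + \<alpha>\<rceil> = \<lceil>y\<rceil>" for y
  proof -
    have "0 < frac y \<longleftrightarrow> \<lceil>y\<rceil> = \<lfloor>y\<rfloor> + 1" "frac y = 0 \<longleftrightarrow> \<lceil>y\<rceil> = \<lfloor>y\<rfloor>"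
      unfolding frac_def by linarith+
    then show ?thesis
      using assms unfolding frac_def by (simp; linarith)
  qed
  from this[of "\<rho> + real n * \<alpha>"] show ?thesis
    using assms by (simp add: sturmian_def rotation_funpow algebra_simps)
qed

lemma irrational_mult_not_int:
  assumes "\<alpha> \<notin> \<rat>" "k \<noteq> 0"
  shows "real_of_int k * \<alpha> \<noteq> of_int m"
proof
  assume "real_of_int k * \<alpha> = of_int m"
  then have "\<alpha> = of_int m / of_int k" using assms by (simp add: field_simps)
  then show False using assms by simp
qed

lemma ceiling_conv_floor_irrational:
  assumes "\<alpha> \<notin> \<rat>" "n > 0"
  shows "\<lceil>real n * \<alpha>\<rceil> = \<lfloor>real n * \<alpha>\<rfloor> + 1"
  using irrational_mult_not_int[of \<alpha> "int n" "\<lfloor>real n * \<alpha>\<rfloor>"] assms by simp linarith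

text \<open>The orbit consists of positive multiples of \<alpha>, which are never integers, so
  ceilings are floors plus one and the conventions agree.\<close>

lemma characteristic_word_eq:
  assumes "0 < \<alpha>" "\<alpha> < 1" "\<alpha> \<notin> \<rat>"
  shows "characteristic_word c \<alpha> = coding \<alpha> \<alpha>"
proof (cases c)
  case Left_Closed
  then show ?thesis using assms by (simp add: characteristic_word_def sturmian_Left_Closed)
next
  case Right_Closed
  have eq: "\<alpha> + real n * \<alpha> = real (Suc n) * \<alpha>" for n by (simp add: algebra_simps)
  show ?thesis
    using Right_Closed assms
    by (intro ext)
      (simp del: of_nat_Suc add: characteristic_word_def sturmian_Right_Closed coding_def eq ceiling_conv_floor_irrational)
qed

section \<open>Factors of a Sturmian word\<close>

lemma eventually_floor_add: "\<forall>\<^sub>F d in at_right 0. \<lfloor>z + d\<rfloor> = \<lfloor>z::real\<rfloor> \<and> \<lceil>z + d\<rceil> = \<lfloor>z\<rfloor> + 1"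
  unfolding eventually_at_right_field
  by (rule exI[of _ "1 - frac z"]) (use frac_lt_1[of z] in \<open>auto simp: frac_def; linarith\<close>)

lemma eventually_floor_diff: "\<forall>\<^sub>F d in at_right 0. \<lfloor>z - d\<rfloor> = \<lceil>z::real\<rceil> - 1"
  unfolding eventually_at_right_field
  \<comment> \<open>The witness is the distance from \<open>z\<close> to the largest integer
    strictly below it.\<close>
  by (rule exI[of _ "z - of_int \<lceil>z\<rceil> + 1"]) (intro conjI allI impI; linarith)

text \<open>
  The right-hand side mentions neither the intercept nor the convention: a small shift to the left turns
  the ceilings of the right-closed convention into floors, and a small shift to the right does not change
  the floors but makes room for a point of the orbit.
\<close>

lemma sturmian_window_iff:
  assumes "is_sturmian_of_slope c \<alpha> s"
  shows "(\<exists>i. \<forall>j<N. s (i + j) = w j) \<longleftrightarrow> (\<exists>x. \<forall>j<N. coding \<alpha> x j = w j)"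
proof -
  obtain \<rho> where rho: "\<rho> \<in> {0..<1}" "s = sturmian c \<alpha> \<rho>" and irr: "\<alpha> \<notin> \<rat>" and "0 \<le> \<alpha>" "\<alpha> < 1"
    using assms by (auto simp: is_sturmian_of_slope_def)
  then have a: "0 < \<alpha>" "\<alpha> < 1" by (auto simp: order_le_less)
  have "\<exists>x. \<forall>j<N. coding \<alpha> x j = s (i + j)" for i
  proof (cases c)
    case Left_Closed
    then show ?thesis using rho a by (metis coding_add sturmian_Left_Closed)
  next
    case Right_Closed
    have "\<forall>\<^sub>F d in at_right 0. \<forall>j\<in>{..N}. \<lfloor>\<rho> + real (i + j) * \<alpha> - d\<rfloor> = \<lceil>\<rho> + real (i + j) * \<alpha>\<rceil> - 1"
      by (intro eventually_ball_finite ballI eventually_floor_diff) auto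
    then obtain d where d: "\<And>j. j \<le> N \<Longrightarrow>
        \<lfloor>\<rho> + real (i + j) * \<alpha> - d\<rfloor> = \<lceil>\<rho> + real (i + j) * \<alpha>\<rceil> - 1"
      unfolding eventually_at_right_field by (metis atMost_iff dense)
    have "coding \<alpha> (\<rho> + real i * \<alpha> - d) j = s (i + j)" if "j < N" for j
      using d[of j] d[of "Suc j"] that rho(1) a Right_Closed
      unfolding rho(2) coding_def by (simp add: sturmian_Right_Closed algebra_simps)
    then show ?thesis by blast
  qed
  moreover have "\<exists>i. \<forall>j<N. s (i + j) = coding \<alpha> x j" for x
  proof -
    have "\<forall>\<^sub>F d in at_right 0. \<forall>j\<in>{..N}. \<lfloor>x + real j * \<alpha> + d\<rfloor> = \<lfloor>x + real j * \<alpha>\<rfloor> \<and>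
        \<lceil>x + real j * \<alpha> + d\<rceil> = \<lfloor>x + real j * \<alpha>\<rfloor> + 1"
      by (intro eventually_ball_finite ballI eventually_floor_add) auto
    then obtain e where "e > 0" and e: "\<And>d j. 0 < d \<Longrightarrow> d < e \<Longrightarrow> j \<le> N \<Longrightarrow>
        \<lfloor>x + real j * \<alpha> + d\<rfloor> = \<lfloor>x + real j * \<alpha>\<rfloor> \<and>
        \<lceil>x + real j * \<alpha> + d\<rceil> = \<lfloor>x + real j * \<alpha>\<rfloor> + 1"
      unfolding eventually_at_right_field by auto
    \<comment> \<open>The target is the middle of the interval from \<open>x\<close> to
      \<open>x + e\<close>, so an error below \<open>e / 2\<close> keeps the offset \<open>d\<close>
      strictly between \<open>0\<close> and \<open>e\<close>.\<close>
    obtain h k where hk: "k > 0" "\<bar>of_int k * \<alpha> - of_int h - (x + e / 2 - \<rho>)\<bar> < e / 2"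
      by (rule sequence_of_fractional_parts_is_dense[OF irr, of "e / 2" "x + e / 2 - \<rho>"])
        (use \<open>e > 0\<close> in auto)
    define i where "i = nat k"
    define d where "d = \<rho> + real i * \<alpha> - of_int h - x"
    have d: "0 < d" "d < e" using hk unfolding d_def i_def by (simp_all; linarith)+
    have shift: "\<rho> + real (i + j) * \<alpha> = x + real j * \<alpha> + d + of_int h" for j
      by (simp add: d_def algebra_simps)
    have fl: "\<lfloor>\<rho> + real (i + j) * \<alpha>\<rfloor> = \<lfloor>x + real j * \<alpha>\<rfloor> + h"
      and ce: "\<lceil>\<rho> + real (i + j) * \<alpha>\<rceil> = \<lfloor>x + real j * \<alpha>\<rfloor> + 1 + h" if "j \<le> N" for j
      using e[OF d that] unfolding shift by simp_all
    have "s (i + j) = coding \<alpha> x j" if "j < N" for j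
      using fl[of j] fl[of "Suc j"] ce[of j] ce[of "Suc j"] that rho(1) a
      unfolding rho(2)
      by (cases c) (simp_all add: sturmian_Left_Closed sturmian_Right_Closed coding_def del: of_nat_Suc of_nat_add)
    then show ?thesis by blast
  qed
  ultimately show ?thesis by metis
qed

lemma is_factor_sturmian_iff:
  assumes "is_sturmian_of_slope c \<alpha> s"
  shows "is_factor w s \<longleftrightarrow> (\<exists>x. w = prefix (length w) (coding \<alpha> x))"
proof -
  have "w = subsequence s i (i + length w) \<longleftrightarrow> (\<forall>j<length w. s (i + j) = w ! j)" for i
    by (subst list_eq_iff_nth_eq) (auto simp: subsequence_def)
  moreover have "w = prefix (length w) (coding \<alpha> x) \<longleftrightarrow> (\<forall>j<length w. coding \<alpha> x j = w ! j)" for x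
    by (subst list_eq_iff_nth_eq) (auto simp: subsequence_def)
  ultimately show ?thesis
    using sturmian_window_iff[OF assms, of "length w" "(!) w"] by (simp add: is_factor_def)
qed

section \<open>Boundary sets as a block coding\<close>

text \<open>The middle word imposes no condition: it is whatever the coding of \<open>x\<close>
  reads between the two windows.\<close>

lemma mem_boundary_sturmian_iff:
  assumes "is_sturmian_of_slope c \<alpha> s" "l \<le> n"
  shows "(u, v) \<in> boundary s l n \<longleftrightarrow>
    (\<exists>x. u = prefix l (coding \<alpha> x) \<and> v = prefix l (coding \<alpha> (x + real n * \<alpha>)))"
proof -
  have split: "prefix (n + l) (coding \<alpha> x) =
      prefix l (coding \<alpha> x) @ subsequence (coding \<alpha> x) l n @ prefix l (coding \<alpha> (x + real n * \<alpha>))" for x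
  proof -
    have "prefix n (coding \<alpha> x) = prefix l (coding \<alpha> x) @ subsequence (coding \<alpha> x) l n"
      using subsequence_append[of "coding \<alpha> x" l "n - l"] assms(2) by simp
    moreover have "subsequence (coding \<alpha> x) n (n + l) = prefix l (coding \<alpha> (x + real n * \<alpha>))"
      by (rule nth_equalityI) (simp_all add: coding_add)
    ultimately show ?thesis by (simp add: subsequence_append)
  qed
  show ?thesis
  proof
    assume "(u, v) \<in> boundary s l n"
    then obtain y where "length u = l" "length v = l" "length y = n - l" "is_factor (u @ y @ v) s"
      by (auto simp: boundary_def words_of_length_def)
    moreover from this obtain x where "u @ y @ v = prefix (n + l) (coding \<alpha> x)"
      using assms by (auto simp: is_factor_sturmian_iff add.commute)
    ultimately show "\<exists>x. u = prefix l (coding \<alpha> x) \<and> v = prefix l (coding \<alpha> (x + real n * \<alpha>))"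
      unfolding split by (intro exI[of _ x]) (auto simp: append_eq_append_conv)
  next
    assume "\<exists>x. u = prefix l (coding \<alpha> x) \<and> v = prefix l (coding \<alpha> (x + real n * \<alpha>))"
    then obtain x where x: "u = prefix l (coding \<alpha> x)" "v = prefix l (coding \<alpha> (x + real n * \<alpha>))" by blast
    have "is_factor (u @ subsequence (coding \<alpha> x) l n @ v) s"
      unfolding x split[symmetric] is_factor_sturmian_iff[OF assms(1)]
      by (intro exI[of _ x]) (simp add: subsequence_length)
    then show "(u, v) \<in> boundary s l n"
      by (auto simp: boundary_def words_of_length_def x intro!: exI[of _ "subsequence (coding \<alpha> x) l n"])
  qed
qed

text \<open>Helly's theorem on the line, for the half-open intervals \<open>[K j - q j, K j + 1 - q j)\<close>.\<close>

lemma exists_common_floor_translate: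
  fixes q :: "'a \<Rightarrow> real" and K :: "'a \<Rightarrow> int"
  assumes "finite J" and less: "\<And>i j. i \<in> J \<Longrightarrow> j \<in> J \<Longrightarrow> q j - q i < K j + 1 - K i"
  shows "\<exists>x. \<forall>j\<in>J. \<lfloor>x + q j\<rfloor> = K j"
proof (cases "J = {}")
  case False
  \<comment> \<open>The largest left endpoint lies below every right endpoint by the pairwise
    condition, hence in all intervals.\<close>
  define x where "x = Max ((\<lambda>j. K j - q j) ` J)"
  have "x \<in> (\<lambda>j. K j - q j) ` J" unfolding x_def using False assms(1) by (intro Max_in) auto
  then obtain i where i: "i \<in> J" "x = K i - q i" by auto
  have "K j - q j \<le> x" if "j \<in> J" for j unfolding x_def using assms(1) that by (intro Max_ge) auto
  then have "\<lfloor>x + q j\<rfloor> = K j" if "j \<in> J" for j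
    using that less[OF i(1) that] i(2) by (simp add: floor_eq_iff) (smt (verit))
  then show ?thesis by blast
qed simp

text \<open>A witness \<open>x\<close> for \<open>n\<close> is replaced by some \<open>x'\<close>
  for \<open>n'\<close> with the same floors in the window of \<open>u\<close> and floors raised by
  \<open>D\<close> in that of \<open>v\<close>. For the existence of \<open>x'\<close> it suffices
  to compare pairs: within one window the inequality is inherited from \<open>x\<close>, across
  windows it follows from \<open>fl\<close>.\<close>

lemma boundary_subset_if_floor_eq:
  assumes s: "is_sturmian_of_slope c \<alpha> s" and a: "0 < \<alpha>" "\<alpha> < 1"
    and n: "l \<le> n" "l < n'"
    and fl: "\<And>j. \<bar>j\<bar> \<le> int l \<Longrightarrow>
      \<lfloor>real n' * \<alpha> + of_int j * \<alpha>\<rfloor> = \<lfloor>real n * \<alpha> + of_int j * \<alpha>\<rfloor> + D"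
  shows "boundary s l n \<subseteq> boundary s l n'"
proof (rule subrelI)
  fix u v assume "(u, v) \<in> boundary s l n"
  then obtain x where x: "u = prefix l (coding \<alpha> x)" "v = prefix l (coding \<alpha> (x + real n * \<alpha>))"
    using mem_boundary_sturmian_iff[OF s n(1)] by blast
  \<comment> \<open>The flag \<open>b\<close> selects the window: \<open>False\<close> for
    \<open>u\<close>, \<open>True\<close> for \<open>v\<close>.\<close>
  define q where "q = (\<lambda>(b, j). real j * \<alpha> + (if b then real n' * \<alpha> else 0))"
  define K where "K = (\<lambda>(b, j). if b then \<lfloor>x + real n * \<alpha> + real j * \<alpha>\<rfloor> + D else \<lfloor>x + real j * \<alpha>\<rfloor>)"
  have "q z' - q z < K z' + 1 - K z" if z: "z \<in> UNIV \<times> {..l}" "z' \<in> UNIV \<times> {..l}" for z z'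
  proof -
    obtain b i b' j where zz: "z = (b, i)" "z' = (b', j)" by (metis surj_pair)
    have ij: "i \<le> l" "j \<le> l" using z zz by auto
    let ?t = "\<lambda>n i j. real n * \<alpha> + (real i * \<alpha> - real j * \<alpha>)"
    have t: "?t n i j = real n * \<alpha> + of_int (int i - int j) * \<alpha>" for n i j
      by (simp add: algebra_simps)
    have D: "\<lfloor>?t n' i j\<rfloor> = \<lfloor>?t n i j\<rfloor> + D" if "i \<le> l" "j \<le> l" for i j
      unfolding t using that by (intro fl) auto
    \<comment> \<open>Here \<open>l < n'\<close> matters: the multiple of \<alpha> is nonzero, hence
      no integer. Strictness is needed because half-open intervals that only touch do not
      meet.\<close>
    have "int n' + (int i - int j) \<noteq> 0" using ij n by linarith
    then have "?t n' i j \<noteq> of_int m" for m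
      using irrational_mult_not_int[of \<alpha> "int n' + (int i - int j)" m] s
      by (simp add: is_sturmian_of_slope_def algebra_simps)
    then have strict: "of_int \<lfloor>?t n' i j\<rfloor> < ?t n' i j" by (metis floor_correct order_le_less)
    have lower: "\<lfloor>x + real n * \<alpha> + real i * \<alpha>\<rfloor> - \<lfloor>x + real j * \<alpha>\<rfloor> - 1 \<le> \<lfloor>?t n i j\<rfloor>"
      by (simp add: le_floor_iff) linarith
    have "\<lfloor>?t n j i\<rfloor> \<le> \<lfloor>x + real n * \<alpha> + real j * \<alpha>\<rfloor> - \<lfloor>x + real i * \<alpha>\<rfloor>"
      by (simp add: floor_le_iff) linarith
    then have upper: "\<lfloor>?t n' j i\<rfloor> \<le> \<lfloor>x + real n * \<alpha> + real j * \<alpha>\<rfloor> - \<lfloor>x + real i * \<alpha>\<rfloor> + D"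
      unfolding D[OF ij(2,1)] by simp
    show ?thesis
    proof (cases b; cases b')
      assume "b" "\<not> b'"
      then show ?thesis
        using strict lower unfolding D[OF ij] by (simp add: zz q_def K_def; linarith)
    next
      assume "\<not> b" "b'"
      then show ?thesis
        using upper by (simp add: zz q_def K_def; linarith)
    qed (simp add: zz q_def K_def; linarith)+
  qed
  then have "\<exists>x'. \<forall>z\<in>UNIV \<times> {..l}. \<lfloor>x' + q z\<rfloor> = K z"
    by (intro exists_common_floor_translate) simp_all
  then obtain x' where x': "\<And>b j. j \<le> l \<Longrightarrow> \<lfloor>x' + q (b, j)\<rfloor> = K (b, j)"
    by auto
  have F: "\<lfloor>x' + real j * \<alpha>\<rfloor> = \<lfloor>x + real j * \<alpha>\<rfloor>" if "j \<le> l" for j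
    using x'[OF that, of False] by (simp add: q_def K_def)
  have G: "\<lfloor>x' + real n' * \<alpha> + real j * \<alpha>\<rfloor> = \<lfloor>x + real n * \<alpha> + real j * \<alpha>\<rfloor> + D" if "j \<le> l" for j
    using x'[OF that, of True] by (simp add: q_def K_def algebra_simps)
  have "u = prefix l (coding \<alpha> x')"
    using F F[of 0] unfolding x(1) prefix_coding_eq_iff[OF a] by simp
  moreover have "v = prefix l (coding \<alpha> (x' + real n' * \<alpha>))"
    using G G[of 0] unfolding x(2) prefix_coding_eq_iff[OF a] by simp
  ultimately show "(u, v) \<in> boundary s l n'"
    using mem_boundary_sturmian_iff[OF s, of l n'] n by auto
qed

text \<open>With intercept \<alpha>, the block at \<open>m\<close> records the floors of
  \<open>(m + 1 + i)\<alpha>\<close> for \<open>i \<le> 2l\<close>: the window of radius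
  \<open>l\<close> around \<open>n = l + m + 1\<close>. The two inclusions use opposite values of
  \<open>D\<close>.\<close>

lemma boundary_eq_if_block_eq:
  assumes s: "is_sturmian_of_slope c \<alpha> s" and a: "0 < \<alpha>" "\<alpha> < 1"
    and eq: "subsequence (coding \<alpha> \<alpha>) m (m + 2 * l) = subsequence (coding \<alpha> \<alpha>) m' (m' + 2 * l)"
  shows "boundary s l (Suc (l + m)) = boundary s l (Suc (l + m'))"
proof -
  let ?x = "\<lambda>m. real (Suc m) * \<alpha>"
  have block: "subsequence (coding \<alpha> \<alpha>) m (m + 2 * l) = prefix (2 * l) (coding \<alpha> (?x m))" for m
    by (rule nth_equalityI) (simp_all add: coding_add distrib_right)
  have fl: "\<lfloor>?x m + real i * \<alpha>\<rfloor> - \<lfloor>?x m\<rfloor> = \<lfloor>?x m' + real i * \<alpha>\<rfloor> - \<lfloor>?x m'\<rfloor>" if "i \<le> 2 * l" for i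
    using eq that unfolding block prefix_coding_eq_iff[OF a] by blast
  have rew: "real (Suc (l + m)) * \<alpha> + of_int j * \<alpha> = ?x m + real (nat (int l + j)) * \<alpha>"
    if "\<bar>j\<bar> \<le> int l" for m j
    using that by (simp add: algebra_simps)
  have le: "nat (int l + j) \<le> 2 * l" if "\<bar>j\<bar> \<le> int l" for j using that by linarith
  show ?thesis
  proof (rule antisym)
    show "boundary s l (Suc (l + m)) \<subseteq> boundary s l (Suc (l + m'))"
      by (rule boundary_subset_if_floor_eq[OF s a, where D = "\<lfloor>?x m'\<rfloor> - \<lfloor>?x m\<rfloor>"])
        (use fl le in \<open>auto simp only: rew; force\<close>)+
    show "boundary s l (Suc (l + m')) \<subseteq> boundary s l (Suc (l + m))"
      by (rule boundary_subset_if_floor_eq[OF s a, where D = "\<lfloor>?x m\<rfloor> - \<lfloor>?x m'\<rfloor>"])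
        (use fl le in \<open>auto simp only: rew; force\<close>)+
  qed
qed

section \<open>Renormalization of characteristic words\<close>

text \<open>For \<open>n > 0\<close> irrationality gives \<open>\<lfloor>n(1 - \<beta>)\<rfloor> = n
  - 1 - \<lfloor>n\<beta>\<rfloor>\<close>, so one floor increases exactly when the other does
  not.\<close>

lemma is_image_swap:
  assumes "0 < \<beta>" "\<beta> < 1" "\<beta> \<notin> \<rat>"
  shows "is_image (morph (\<lambda>b. if b = 0 then [1] else [0]))
    (coding \<beta> \<beta>) (coding (1 - \<beta>) (1 - \<beta>))"
    (is "is_image (morph ?f) _ _")
proof (rule is_imageI)
  fix n i assume "i < length (?f (coding \<beta> \<beta> n))"
  then have "i = 0" by (simp split: if_splits)
  have len: "length (morph ?f w) = length w" for w
    by (induction w) auto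
  have floor: "\<lfloor>real (Suc j) * (1 - \<beta>)\<rfloor> = int j - \<lfloor>real (Suc j) * \<beta>\<rfloor>" for j
  proof -
    have "\<lfloor>real (Suc j) * (1 - \<beta>)\<rfloor> = int (Suc j) - \<lceil>real (Suc j) * \<beta>\<rceil>"
      by (simp add: right_diff_distrib) linarith
    then show ?thesis using ceiling_conv_floor_irrational[OF assms(3), of "Suc j"] by simp
  qed
  have inc: "\<lfloor>real (Suc (Suc n)) * \<beta>\<rfloor> = \<lfloor>real (Suc n) * \<beta>\<rfloor> \<or>
      \<lfloor>real (Suc (Suc n)) * \<beta>\<rfloor> = \<lfloor>real (Suc n) * \<beta>\<rfloor> + 1"
    using assms by (simp add: distrib_right) linarith
  have eq: "x + real j * x = real (Suc j) * x" for x :: real and j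
    by (simp add: algebra_simps)
  show "coding (1 - \<beta>) (1 - \<beta>) (length (morph ?f (prefix n (coding \<beta> \<beta>))) + i) =
      ?f (coding \<beta> \<beta> n) ! i"
    unfolding coding_def eq floor len \<open>i = 0\<close> using inc by auto
qed simp

text \<open>
  The rotation by \<open>\<gamma>\<close> is induced by the rotation by \<open>\<delta>\<close>: at the beginning of the image of a letter
  read at \<open>y\<close>, the orbit of \<open>\<delta>\<close> is at \<open>\<lfloor>y\<rfloor> + frac y / (1 + \<gamma>)\<close>.
\<close>

lemma is_image_insert0:
  assumes "0 < \<gamma>" "\<gamma> < 1"
  defines "\<delta> \<equiv> \<gamma> / (1 + \<gamma>)"
  shows "is_image (morph (\<lambda>b. if b = 0 then [0] else [0, 1])) (coding \<gamma> \<gamma>) (coding \<delta> \<delta>)"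
    (is "is_image (morph ?f) _ _")
proof (rule is_imageI)
  fix n i assume i: "i < length (?f (coding \<gamma> \<gamma> n))"
  define y where "y m = real (Suc m) * \<gamma>" for m
  have y: "\<gamma> + real m * \<gamma> = y m" "y (Suc m) = y m + \<gamma>" "y m > 0" for m
    using assms by (simp_all add: y_def algebra_simps add_pos_nonneg)
  have coding_y: "coding \<gamma> \<gamma> m = (if \<lfloor>y (Suc m)\<rfloor> = \<lfloor>y m\<rfloor> then 0 else 1)" for m
    by (simp only: coding_def y(1))
  \<comment> \<open>Each letter \<open>1\<close> contributes one extra letter, and
    \<open>\<lfloor>y m\<rfloor>\<close> counts the letters \<open>1\<close> read so far.\<close>
  have len: "int (length (morph ?f (prefix m (coding \<gamma> \<gamma>)))) = int m + \<lfloor>y m\<rfloor>" for m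
  proof (induction m)
    case 0
    then show ?case using assms by (simp add: y_def subsequence_def floor_eq_iff)
  next
    case (Suc m)
    have "\<lfloor>y (Suc m)\<rfloor> = \<lfloor>y m\<rfloor> \<or> \<lfloor>y (Suc m)\<rfloor> = \<lfloor>y m\<rfloor> + 1"
      unfolding y(2) using assms by linarith
    then show ?case using Suc by (auto simp: prefix_Suc coding_y)
  qed
  define N where "N = length (morph ?f (prefix n (coding \<gamma> \<gamma>)))"
  define r where "r = frac (y n)"
  have r: "0 \<le> r" "r < 1" by (simp_all add: r_def frac_lt_1)
  have "real N = real_of_int (int n + \<lfloor>y n\<rfloor>)" using len[of n] by (metis N_def of_int_of_nat_eq)
  then have "real (Suc N) * \<gamma> = y n + of_int \<lfloor>y n\<rfloor> * \<gamma>" by (simp add: y_def algebra_simps)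
  also have "\<dots> = of_int \<lfloor>y n\<rfloor> * (1 + \<gamma>) + r" by (simp add: r_def frac_def algebra_simps)
  finally have N: "real (Suc N) * \<gamma> = of_int \<lfloor>y n\<rfloor> * (1 + \<gamma>) + r" .
  have orbit: "\<delta> + real (N + j) * \<delta> = of_int \<lfloor>y n\<rfloor> + (r + real j * \<gamma>) / (1 + \<gamma>)" for j
  proof -
    have "\<delta> + real (N + j) * \<delta> = (real (Suc N) * \<gamma> + real j * \<gamma>) / (1 + \<gamma>)"
      by (simp add: \<delta>_def algebra_simps flip: add_divide_distrib)
    also have "\<dots> = (of_int \<lfloor>y n\<rfloor> * (1 + \<gamma>) + (r + real j * \<gamma>)) / (1 + \<gamma>)"
      unfolding N by (simp add: add.assoc)
    also have "\<dots> = of_int \<lfloor>y n\<rfloor> + (r + real j * \<gamma>) / (1 + \<gamma>)"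
      using assms by (subst add_divide_distrib) simp
    finally show ?thesis .
  qed
  \<comment> \<open>An image has at most two letters, which are decided by three floors.\<close>
  have fl: "\<lfloor>\<delta> + real (N + j) * \<delta>\<rfloor> = \<lfloor>y n\<rfloor> + (if r + real j * \<gamma> < 1 + \<gamma> then 0 else 1)" if "j \<le> 2" for j
  proof -
    have "r + real j * \<gamma> < 2 * (1 + \<gamma>)"
      using r that assms by (auto simp: le_Suc_eq numeral_2_eq_2)
    moreover have "0 \<le> r + real j * \<gamma>" using r assms by simp
    ultimately show ?thesis
      unfolding orbit using assms by (simp add: floor_eq_iff field_simps)
  qed
  have letter: "coding \<gamma> \<gamma> n = (if r + \<gamma> < 1 then 0 else 1)"
  proof -
    have "\<lfloor>y n + \<gamma>\<rfloor> = \<lfloor>y n\<rfloor> \<longleftrightarrow> r + \<gamma> < 1"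
      using assms unfolding r_def frac_def by linarith
    then show ?thesis by (simp add: coding_y y(2))
  qed
  have "i \<le> 1" using i by (simp split: if_splits)
  then consider "i = 0" | "i = 1" by linarith
  then have "coding \<delta> \<delta> (N + i) = ?f (coding \<gamma> \<gamma> n) ! i"
  proof cases
    case 1
    then show ?thesis
      using fl[of 0] fl[of 1] r assms by (simp add: letter coding_def)
  next
    case 2
    then have "\<not> r + \<gamma> < 1" using i letter by auto
    then have "coding \<delta> \<delta> (N + 1) = 1"
      using fl[of 1] fl[of 2] r assms by (simp add: coding_def numeral_2_eq_2)
    with 2 \<open>\<not> r + \<gamma> < 1\<close> show ?thesis by (simp add: letter)
  qed
  then show "coding \<delta> \<delta> (length (morph ?f (prefix n (coding \<gamma> \<gamma>))) + i) = ?f (coding \<gamma> \<gamma> n) ! i"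
    by (simp add: N_def)
qed simp

definition tau :: "nat \<Rightarrow> bit \<Rightarrow> bit list" where
  "tau m b = (if b = 0 then replicate m 0 @ [1] else [0])"

text \<open>For \<open>m = 0\<close> the slope is \<open>1 - \<beta>\<close> and \<open>tau\<close>
  swaps the letters. Each further \<open>0\<close> comes from \<open>0 \<mapsto> 0\<close>,
  \<open>1 \<mapsto> 01\<close>, which raises the reciprocal of the slope by one.\<close>

lemma is_image_tau:
  assumes "0 < \<beta>" "\<beta> < 1" "\<beta> \<notin> \<rat>" and "\<alpha> = 1 / (real m + 1 / (1 - \<beta>))"
  shows "is_image (morph (tau m)) (coding \<beta> \<beta>) (coding \<alpha> \<alpha>)"
  using assms(4)
proof (induction m arbitrary: \<alpha>)
  case 0
  have "tau 0 = (\<lambda>b. if b = 0 then [1] else [0])" by (auto simp: tau_def)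
  then show ?case using is_image_swap[OF assms(1-3)] 0 by simp
next
  case (Suc m)
  define \<gamma> where "\<gamma> = 1 / (real m + 1 / (1 - \<beta>))"
  have "1 < 1 / (1 - \<beta>)" using assms by simp
  then have "1 < real m + 1 / (1 - \<beta>)" by linarith
  then have \<gamma>: "0 < \<gamma>" "\<gamma> < 1" by (simp_all add: \<gamma>_def)
  have "1 / \<gamma> = real m + 1 / (1 - \<beta>)" by (simp add: \<gamma>_def)
  then have "\<alpha> = 1 / (1 + 1 / \<gamma>)" using Suc.prems by (simp add: add.assoc)
  then have "\<alpha> = \<gamma> / (1 + \<gamma>)" using \<gamma> by (simp add: field_simps)
  then have "is_image (morph (\<lambda>b. if b = 0 then [0] else [0, 1])) (coding \<gamma> \<gamma>) (coding \<alpha> \<alpha>)"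
    (is "is_image (morph ?f) _ _")
    using is_image_insert0[OF \<gamma>] by simp
  from is_image_comp[OF Suc.IH[OF \<gamma>_def] this]
  have "is_image (morph (\<lambda>b. morph ?f (tau m b))) (coding \<beta> \<beta>) (coding \<alpha> \<alpha>)" .
  moreover have "morph ?f (replicate m 0) = replicate m 0" by (induction m) auto
  then have "(\<lambda>b. morph ?f (tau m b)) = tau (Suc m)"
    by (auto simp: tau_def fun_eq_iff replicate_append_same)
  ultimately show ?case by simp
qed

section \<open>Continued fractions\<close>

lemma finite_cf_bounds:
  assumes "\<forall>b\<in>set bs. b \<ge> 1"
  shows "0 \<le> finite_cf bs" "finite_cf bs \<le> 1"
proof -
  have "0 \<le> finite_cf bs \<and> finite_cf bs \<le> 1"
    using assms by (induction bs) (auto simp: divide_simps)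
  then show "0 \<le> finite_cf bs" "finite_cf bs \<le> 1" by auto
qed

text \<open>Two partial quotients are removed at a time: the difference is then divided by
  \<open>X * Y \<ge> 4\<close>, whereas a single step need not contract by a fixed factor.\<close>

lemma finite_cf_append_diff:
  assumes "\<forall>b\<in>set (p @ bs @ cs). b \<ge> 1"
  shows "\<bar>finite_cf (p @ bs) - finite_cf (p @ cs)\<bar> \<le> 2 * (1 / 2) ^ length p"
  using assms
proof (induction p rule: induct_list012)
  case 1
  then show ?case using finite_cf_bounds[of bs] finite_cf_bounds[of cs] by (simp add: abs_if)
next
  case (2 b)
  then have "\<forall>c\<in>set (b # bs). c \<ge> 1" "\<forall>c\<in>set (b # cs). c \<ge> 1" by auto
  from finite_cf_bounds[OF this(1)] finite_cf_bounds[OF this(2)] show ?case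
    by (simp del: finite_cf.simps; linarith)
next
  case (3 b c p)
  define x where "x = finite_cf (p @ bs)"
  define y where "y = finite_cf (p @ cs)"
  have bc: "real b \<ge> 1" "real c \<ge> 1" using 3 by auto
  have xy: "0 \<le> x" "0 \<le> y"
    using finite_cf_bounds[of "p @ bs"] finite_cf_bounds[of "p @ cs"] 3 by (auto simp: x_def y_def)
  define X where "X = real b * (real c + x) + 1"
  define Y where "Y = real b * (real c + y) + 1"
  have "1 * 1 \<le> real b * (real c + x)" "1 * 1 \<le> real b * (real c + y)"
    using bc xy by (intro mult_mono; simp)+
  then have XY: "2 \<le> X" "2 \<le> Y" by (simp_all add: X_def Y_def)
  then have "2 * 2 \<le> X * Y" by (intro mult_mono) auto
  have "finite_cf ((b # c # p) @ bs) - finite_cf ((b # c # p) @ cs) = (real c + x) / X - (real c + y) / Y"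
    using bc xy by (simp add: x_def[symmetric] y_def[symmetric] X_def Y_def field_simps)
  also have "\<dots> = (x - y) / (X * Y)"
    using XY by (simp add: diff_frac_eq) (simp add: X_def Y_def algebra_simps)
  finally have "\<bar>finite_cf ((b # c # p) @ bs) - finite_cf ((b # c # p) @ cs)\<bar> = \<bar>x - y\<bar> / (X * Y)"
    using XY by (simp add: abs_mult)
  also have "\<dots> \<le> \<bar>x - y\<bar> / 4" using \<open>2 * 2 \<le> X * Y\<close> by (intro divide_left_mono) auto
  also have "\<dots> \<le> 2 * (1 / 2) ^ length p / 4"
    using 3 by (intro divide_right_mono) (auto simp: x_def y_def)
  finally show ?case by simp
qed

lemma cf_cong:
  assumes "\<And>i. i \<ge> 1 \<Longrightarrow> b i = c i"
  shows "cf b = cf c"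
proof -
  have "map b [1..<Suc n] = map c [1..<Suc n]" for n
    using assms by (intro map_cong) auto
  then show ?thesis unfolding cf_def by metis
qed

lemma finite_cf_LIMSEQ:
  assumes "\<And>i. i \<ge> 1 \<Longrightarrow> b i \<ge> 1"
  shows "(\<lambda>n. finite_cf (map b [1..<Suc n])) \<longlonglongrightarrow> cf b"
proof -
  let ?T = "\<lambda>n. finite_cf (map b [1..<Suc n])"
  have diff: "\<bar>?T n - ?T m\<bar> \<le> 2 * (1 / 2) ^ k" if "k \<le> n" "k \<le> m" for k n m
  proof -
    have split: "map b [1..<Suc n] = map b [1..<Suc k] @ map b [Suc k..<Suc n]" if "k \<le> n" for n
      using that upt_add_eq_append[of 1 "Suc k" "n - k"] by (simp del: upt_Suc flip: map_append)
    show ?thesis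
      unfolding split[OF that(1)] split[OF that(2)]
      by (rule order_trans[OF finite_cf_append_diff]) (use assms in auto)
  qed
  have "Cauchy ?T"
  proof (rule metric_CauchyI)
    fix e :: real assume "e > 0"
    then obtain k where k: "(1 / 2) ^ k < e / 2"
      using real_arch_pow_inv[of "e / 2" "1 / 2"] by auto
    show "\<exists>M. \<forall>m\<ge>M. \<forall>n\<ge>M. dist (?T m) (?T n) < e"
      using diff[of k] k by (intro exI[of _ k]) (smt (verit) dist_real_def field_sum_of_halves)
  qed
  then show ?thesis
    unfolding cf_def by (simp add: Cauchy_convergent_iff convergent_LIMSEQ_iff)
qed

lemma cf_bounds:
  assumes "\<And>i. i \<ge> 1 \<Longrightarrow> b i \<ge> 1"
  shows "0 \<le> cf b" "cf b \<le> 1"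
proof -
  have "\<forall>c\<in>set (map b [1..<Suc n]). c \<ge> 1" for n using assms by auto
  note bounds = finite_cf_bounds[OF this]
  show "0 \<le> cf b" "cf b \<le> 1"
    by (rule LIMSEQ_le_const[OF finite_cf_LIMSEQ[OF assms]], assumption, use bounds in blast)
      (rule LIMSEQ_le_const2[OF finite_cf_LIMSEQ[OF assms]], assumption, use bounds in blast)
qed

lemma cf_rec:
  assumes "\<And>i. i \<ge> 1 \<Longrightarrow> b i \<ge> 1"
  shows "cf b = 1 / (real (b 1) + cf (\<lambda>i. b (Suc i)))"
proof (rule LIMSEQ_unique)
  let ?b = "\<lambda>i. b (Suc i)"
  show "(\<lambda>n. finite_cf (map b [1..<Suc (Suc n)])) \<longlonglongrightarrow> cf b"
    using LIMSEQ_Suc[OF finite_cf_LIMSEQ[OF assms]] .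
  have "map b [1..<Suc (Suc n)] = b 1 # map ?b [1..<Suc n]" for n
    by (simp add: upt_conv_Cons map_Suc_upt[symmetric] o_def del: upt_Suc)
  moreover have "1 \<le> real (b 1)" "0 \<le> cf ?b"
    using assms[of 1] by (simp, intro cf_bounds(1) assms) simp
  then have "real (b 1) + cf ?b \<noteq> 0" by linarith
  then have "(\<lambda>n. 1 / (real (b 1) + finite_cf (map ?b [1..<Suc n]))) \<longlonglongrightarrow> 1 / (real (b 1) + cf ?b)"
    using assms by (intro tendsto_intros finite_cf_LIMSEQ) auto
  ultimately show "(\<lambda>n. finite_cf (map b [1..<Suc (Suc n)])) \<longlonglongrightarrow> 1 / (real (b 1) + cf ?b)"
    by simp
qed

lemma slope_cf_eq:
  assumes "\<And>i. i \<ge> 2 \<Longrightarrow> a i \<ge> 1"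
  shows "slope_cf a = 1 / (real (a 1) + 1 + cf (\<lambda>i. a (Suc i)))"
proof -
  let ?b = "\<lambda>i. if i = 1 then a 1 + 1 else a i"
  have "cf ?b = 1 / (real (?b 1) + cf (\<lambda>i. ?b (Suc i)))"
    by (rule cf_rec) (use assms in auto)
  moreover have "cf (\<lambda>i. ?b (Suc i)) = cf (\<lambda>i. a (Suc i))"
    by (rule cf_cong) auto
  ultimately show ?thesis by (simp add: slope_cf_def)
qed

lemma slope_cf_bounds:
  assumes "\<And>i. i \<ge> 1 \<Longrightarrow> a i \<ge> 1"
  shows "0 < slope_cf a" "slope_cf a < 1"
proof -
  have "1 \<le> real (a 1)" "0 \<le> cf (\<lambda>i. a (Suc i))"
    using assms[of 1] by (simp, intro cf_bounds(1) assms) simp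
  then have "1 < real (a 1) + 1 + cf (\<lambda>i. a (Suc i))" by linarith
  then show "0 < slope_cf a" "slope_cf a < 1"
    using assms by (simp_all add: slope_cf_eq)
qed

text \<open>If \<open>y\<close> is the tail that starts with \<open>a 2\<close>, the shifted slope
  is \<open>1 / (y + 1)\<close>, and \<open>1 / (1 - 1 / (y + 1)) = 1 + 1 / y\<close>. This brings
  the recursion into the form required by \<open>is_image_tau\<close>.\<close>

lemma slope_cf_Suc:
  assumes "\<And>i. i \<ge> 2 \<Longrightarrow> a i \<ge> 1"
  shows "slope_cf a = 1 / (real (a 1) + 1 / (1 - slope_cf (\<lambda>i. a (Suc i))))"
proof -
  define x where "x = cf (\<lambda>i. a (Suc i))"
  define y where "y = real (a 2) + cf (\<lambda>i. a (Suc (Suc i)))"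
  have "real (a 2) \<ge> 1" using assms[of 2] by simp
  moreover have "0 \<le> cf (\<lambda>i. a (Suc (Suc i)))" using assms by (intro cf_bounds(1)) simp
  ultimately have "0 < y" unfolding y_def by linarith
  moreover have "x = 1 / y"
    using cf_rec[of "\<lambda>i. a (Suc i)"] assms by (simp add: x_def y_def numeral_2_eq_2)
  moreover have "slope_cf (\<lambda>i. a (Suc i)) = 1 / (y + 1)"
    using slope_cf_eq[of "\<lambda>i. a (Suc i)"] assms by (simp add: y_def numeral_2_eq_2 add_ac)
  moreover from \<open>0 < y\<close> have "1 / (1 - 1 / (y + 1)) = 1 + 1 / y"
    by (simp add: field_simps)
  ultimately have "1 / (1 - slope_cf (\<lambda>i. a (Suc i))) = 1 + x"
    by simp
  then show ?thesis using slope_cf_eq[of a] assms by (simp add: x_def)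
qed

section \<open>Iterated morphisms and the final block coding\<close>

text \<open>
  Here \<open>mu a k 0\<close> and \<open>mu a k 1\<close> are the standard words \<open>s\<^sub>k\<close> and \<open>s\<close> with index \<open>k - 1\<close>, where each standard
  word is the power of its predecessor with exponent the next partial quotient, followed by the word before.
\<close>

fun mu :: "(nat \<Rightarrow> nat) \<Rightarrow> nat \<Rightarrow> bit \<Rightarrow> bit list" where
  "mu a 0 b = [b]"
| "mu a (Suc k) b = morph (mu a k) (tau (a (Suc k)) b)"

text \<open>Irrationality is carried through the induction: each slope is a rational expression in
  the next one.\<close>

lemma is_image_mu:
  assumes a: "\<And>i. i \<ge> 2 \<Longrightarrow> a i \<ge> 1" and irr: "slope_cf a \<notin> \<rat>"
  defines "\<beta> \<equiv> \<lambda>k. slope_cf (\<lambda>i. a (k + i))"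
  shows "\<beta> k \<notin> \<rat> \<and> is_image (morph (mu a k)) (coding (\<beta> k) (\<beta> k)) (coding (\<beta> 0) (\<beta> 0))"
proof (induction k)
  case 0
  have "morph (\<lambda>b. [b]) w = w" for w :: "bit list" by (induction w) auto
  then show ?case using irr by (auto simp: \<beta>_def is_image_def)
next
  case (Suc k)
  have rec: "\<beta> k = 1 / (real (a (Suc k)) + 1 / (1 - \<beta> (Suc k)))"
    using slope_cf_Suc[of "\<lambda>i. a (k + i)"] a by (simp add: \<beta>_def)
  have "\<beta> (Suc k) \<notin> \<rat>"
  proof
    assume "\<beta> (Suc k) \<in> \<rat>"
    then have "\<beta> k \<in> \<rat>" unfolding rec by (intro Rats_divide Rats_add Rats_diff Rats_1) auto
    then show False using Suc by simp
  qed
  moreover have "0 < \<beta> (Suc k)" "\<beta> (Suc k) < 1"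
    unfolding \<beta>_def using a by (intro slope_cf_bounds; simp)+
  ultimately have "is_image (morph (tau (a (Suc k)))) (coding (\<beta> (Suc k)) (\<beta> (Suc k))) (coding (\<beta> k) (\<beta> k))"
    using is_image_tau rec by blast
  from is_image_comp[OF this conjunct2[OF Suc]] \<open>\<beta> (Suc k) \<notin> \<rat>\<close> show ?case
    by simp
qed

lemma mu_ne: "mu a k b \<noteq> []"
proof (induction k arbitrary: b)
  case (Suc k)
  then show ?case by (simp add: tau_def)
qed simp

text \<open>A positive exponent makes each word contain its predecessor and a further nonempty word.
  The induction starts at \<open>1\<close> because \<open>a 1\<close> may be
  \<open>0\<close>.\<close>

lemma length_mu_0:
  assumes "\<And>i. i \<ge> 2 \<Longrightarrow> a i \<ge> 1" "k \<ge> 1"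
  shows "k \<le> length (mu a k 0)"
  using \<open>k \<ge> 1\<close>
proof (induction k rule: dec_induct)
  case base
  then show ?case using mu_ne[of a 1 0] by (simp add: Suc_leI)
next
  case (step k)
  from step obtain j where "a (Suc k) = Suc j" using assms(1)[of "Suc k"] by (cases "a (Suc k)") auto
  moreover have "1 \<le> length (mu a k 1)" using mu_ne[of a k 1] by (simp add: Suc_leI)
  ultimately show ?case using step by (simp add: tau_def)
qed

text \<open>With a positive exponent both images under \<open>tau\<close> begin with
  \<open>0\<close>; this is the common prefix for the block coding.\<close>

lemma take_mu:
  assumes "a (Suc k) \<ge> 1"
  shows "take (length (mu a k 0)) (mu a (Suc k) b) = mu a k 0"
proof -
  obtain j where "a (Suc k) = Suc j" using assms by (cases "a (Suc k)") auto
  then show ?thesis by (simp add: tau_def)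
qed

theorem proposition4p10:
  fixes c :: convention and \<alpha> :: real and a :: "nat \<Rightarrow> nat" and s :: "bit word"
  assumes "is_sturmian_of_slope c \<alpha> s"
    and "\<alpha> = slope_cf a"
    and "\<And>i. i \<ge> 2 \<Longrightarrow> a i \<ge> 1"
  defines "\<beta> \<equiv> \<lambda>k. slope_cf (\<lambda>i. a (k + i))"
  shows "\<forall>l\<ge>2. \<exists>K. \<forall>k\<ge>K. \<exists>h.
           is_morphism h (Pow (words_of_length l \<times> words_of_length l)) \<and>
           is_image h (characteristic_word c (\<beta> k)) (shift_word (boundary_seq s l))"
proof (intro allI impI)
  fix l :: nat
  have irr: "\<alpha> \<notin> \<rat>" and "0 \<le> \<alpha>" "\<alpha> < 1"
    using assms(1) by (auto simp: is_sturmian_of_slope_def)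
  then have \<alpha>: "0 < \<alpha>" "\<alpha> < 1" by (auto simp: order_le_less)
  define x where "x = coding \<alpha> \<alpha>"
  let ?y = "shift_word (boundary_seq s l)"
  \<comment> \<open>On words that are not blocks of \<open>x\<close> the choice is arbitrary, but
    the value is still a boundary set, so it lies in the target alphabet.\<close>
  define g where "g w = ?y (SOME m. w = subsequence x m (m + 2 * l))" for w
  \<comment> \<open>The shift drops the term for \<open>n = l\<close>, which leaves exactly the
    indices \<open>n > l\<close>.\<close>
  have y_eq: "?y m = boundary s l (Suc (l + m))" for m
    by (simp add: shift_word_def boundary_seq_def)
  have y: "?y m = g (subsequence x m (m + 2 * l))" for m
  proof -
    let ?m = "SOME i. subsequence x m (m + 2 * l) = subsequence x i (i + 2 * l)"
    have "subsequence x m (m + 2 * l) = subsequence x ?m (?m + 2 * l)"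
      by (rule someI[where P = "\<lambda>i. subsequence x m (m + 2 * l) = subsequence x i (i + 2 * l)"]) (rule refl)
    then show ?thesis
      unfolding g_def y_eq x_def by (rule boundary_eq_if_block_eq[OF assms(1) \<alpha>])
  qed
  have g: "g w \<in> Pow (words_of_length l \<times> words_of_length l)" for w
    by (auto simp: g_def y_eq boundary_def)
  show "\<exists>K. \<forall>k\<ge>K. \<exists>h.
           is_morphism h (Pow (words_of_length l \<times> words_of_length l)) \<and>
           is_image h (characteristic_word c (\<beta> k)) ?y"
  \<comment> \<open>For \<open>k = j + 1\<close> the common prefix \<open>mu a j 0\<close> has
    length at least \<open>j\<close>, which covers the block length \<open>2l\<close>.\<close>
  proof (rule exI[of _ "2 * l + 2"], intro allI impI)
    fix k assume "2 * l + 2 \<le> k"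
    then obtain j where j: "k = Suc j" "1 \<le> j" "2 * l \<le> j" by (cases k) auto
    define p where "p = mu a j 0"
    let ?H = "\<lambda>b. map (\<lambda>i. g (take (2 * l) (drop i (mu a k b @ p)))) [0..<length (mu a k b)]"
    have img: "is_image (morph (mu a k)) (coding (\<beta> k) (\<beta> k)) x" and "\<beta> k \<notin> \<rat>"
      using is_image_mu[of a k] assms(2,3) irr by (auto simp: \<beta>_def x_def)
    have "is_image (morph ?H) (coding (\<beta> k) (\<beta> k)) ?y"
    proof (rule is_image_block_coding[OF img])
      show "mu a k b \<noteq> []" for b by (rule mu_ne)
      show "take (length p) (mu a k b) = p" for b
        unfolding p_def j(1) using assms(3) j by (intro take_mu) auto
      show "2 * l \<le> length p"
        using length_mu_0[of a j] assms(3) j by (simp add: p_def)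
    qed (rule y)
    moreover have "0 < \<beta> k" "\<beta> k < 1"
      unfolding \<beta>_def using assms(3) j by (intro slope_cf_bounds; simp)+
    then have "characteristic_word c (\<beta> k) = coding (\<beta> k) (\<beta> k)"
      using \<open>\<beta> k \<notin> \<rat>\<close> by (rule characteristic_word_eq)
    moreover have "is_morphism (morph ?H) (Pow (words_of_length l \<times> words_of_length l))"
      using g by (intro is_morphism_morph) (auto simp: in_lists_conv_set)
    ultimately show "\<exists>h. is_morphism h (Pow (words_of_length l \<times> words_of_length l)) \<and>
        is_image h (characteristic_word c (\<beta> k)) ?y"
      by (intro exI[of _ "morph ?H"] conjI) simp_all
  qed
qed
end
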